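(* Let $K$ be a positive integer, let $p\in\mathbb{Z}$ with $p\neq 0$, and set $q=2K(2pK+1)$. Then \[ \psi\left(\sqrt{p/q}\right)=\frac{2}{3}+\frac{p}{K}-\frac{p}{q}, \] where $\psi$ is the secant zeta function $\psi(r)=\frac{4}{\pi^2}\sum_{n\ge 1}\frac{\sec(n\pi r)}{n^2}$.
   Context: The secant zeta function is $\psi(r)=\frac{4}{\pi^2}\sum_{n\ge1}\frac{\sec(n\pi r)}{n^2}$ (with $\sec x=1/\cos x$); it is even and $2$-periodic in $r$. Note that $p/q>0$ for every admissible $p$ and $K$ (when $p<0$, $q<0$ as well), so $\sqrt{p/q}$ is a positive real number. *)

theory Defs
  imports "HOL-Analysis.Analysis"
begin

definition secant_zeta :: "real \<Rightarrow> real" where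
  "secant_zeta r = 4 / pi^2 * (\<Sum>n. (1 / cos (real (Suc n) * pi * r)) / (real (Suc n))^2)"

end

theory Submission
  imports Defs "HOL-Complex_Analysis.Complex_Analysis"
begin

text \<open>
  Put \<open>r = sqrt (p / q)\<close>, \<open>A = 1 + 2Kr\<close> and \<open>B = 1 - 2Kr\<close>; then \<open>r / B = r / A + 2p\<close>.
  For \<open>\<alpha> \<in> {1, A, B}\<close> integrate \<open>cot(\<pi>\<alpha>z) / (z\<^sup>2 cos(\<pi>rz))\<close> over circles of radius \<open>R \<longrightarrow> \<infinity>\<close> that stay
  away from the poles, so that the integrals tend to 0. The residues at the zeros of \<open>sin(\<pi>\<alpha>z)\<close>
  sum up to a multiple of \<open>\<alpha> \<Sum> sec(n\<pi>r/\<alpha>) / n\<^sup>2\<close>, and by the relation above this series is the same for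
  \<open>A\<close> and \<open>B\<close>. The residues at the zeros of \<open>cos(\<pi>rz)\<close> do not depend on \<open>\<alpha>\<close>, because the three values of
  \<open>\<alpha>\<close> differ by multiples of \<open>2r\<close>. Comparing the three limits yields two linear equations that
  determine the series for \<open>\<alpha> = 1\<close>. All the series converge absolutely since \<open>r\<close> and \<open>r / A\<close> are quadratic
  irrationals and hence badly approximable.
\<close>

section \<open>Convergence at badly approximable numbers\<close>

lemma quadratic_irrational_badly_approximable:
  fixes \<theta> :: real and a b c :: int
  assumes root: "a * \<theta>\<^sup>2 + b * \<theta> + c = 0" and a: "a \<noteq> 0" and irr: "\<theta> \<notin> \<rat>"
  obtains \<kappa> where "\<kappa> > 0" "\<And>n m. n \<noteq> 0 \<Longrightarrow> \<kappa> / real_of_int \<bar>n\<bar> \<le> \<bar>real_of_int n * \<theta> - real_of_int m / 2\<bar>"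
proof -
  \<comment> \<open>For \<open>\<bar>x - \<theta>\<bar> \<le> 1\<close>, \<open>M\<close> bounds the
    cofactor \<open>a * (x + \<theta>) + b\<close> left after splitting off the root
    \<open>\<theta>\<close>.\<close>
  define M where "M = \<bar>a\<bar> * (2 * \<bar>\<theta>\<bar> + 1) + \<bar>b\<bar>"
  have "1 * 1 \<le> real_of_int \<bar>a\<bar> * (2 * \<bar>\<theta>\<bar> + 1)"
    using a by (intro mult_mono) auto
  hence M: "M \<ge> 1" by (simp add: M_def)
  have "1 / (4 * M) / \<bar>n\<bar> \<le> \<bar>n * \<theta> - m / 2\<bar>" if n: "n \<noteq> 0" for n m :: int
  proof -
    define x :: real where "x = m / (2 * n)"
    have xQ: "x \<in> \<rat>" by (simp add: x_def)
    have x\<theta>: "x \<noteq> \<theta>" using xQ irr by auto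
    have fac: "a * x\<^sup>2 + b * x + c = (x - \<theta>) * (a * (x + \<theta>) + b)"
      using root by (simp add: algebra_simps power2_eq_square)
    \<comment> \<open>Otherwise \<open>x\<close> would be the second root, and the sum of the roots
      would make \<open>\<theta>\<close> rational.\<close>
    have "a * (x + \<theta>) + b \<noteq> 0"
    proof
      assume "a * (x + \<theta>) + b = 0"
      hence "\<theta> = - b / a - x" using a by (simp add: field_simps)
      thus False using irr xQ by auto
    qed
    hence nz: "a * x\<^sup>2 + b * x + c \<noteq> 0" using fac x\<theta> by simp
    have eq: "4 * n\<^sup>2 * (a * x\<^sup>2 + b * x + c) = of_int (a * m\<^sup>2 + 2 * b * m * n + 4 * c * n\<^sup>2)"
      using n by (simp add: x_def field_simps power2_eq_square)
    have "a * m\<^sup>2 + 2 * b * m * n + 4 * c * n\<^sup>2 \<noteq> 0"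
      using eq nz n by (metis mult_eq_0_iff of_int_0 of_int_eq_0_iff power_eq_0_iff zero_neq_numeral)
    hence "1 \<le> \<bar>4 * n\<^sup>2 * (a * x\<^sup>2 + b * x + c)\<bar>"
      unfolding eq by linarith
    hence one: "1 \<le> 4 * n\<^sup>2 * \<bar>a * x\<^sup>2 + b * x + c\<bar>" by (simp add: abs_mult)
    have nd: "\<bar>n * \<theta> - m / 2\<bar> = \<bar>n\<bar> * \<bar>x - \<theta>\<bar>"
    proof -
      have "n * \<theta> - m / 2 = - (n * (x - \<theta>))" using n by (simp add: x_def field_simps)
      thus ?thesis by (simp add: abs_mult)
    qed
    have n1: "1 \<le> real_of_int \<bar>n\<bar>" using n by linarith
    have n2: "real_of_int (n\<^sup>2) = \<bar>n\<bar> * \<bar>n\<bar>" by (simp add: power2_eq_square)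
    show ?thesis
    proof (cases "\<bar>x - \<theta>\<bar> \<le> 1")
      case True
      have "\<bar>a * (x + \<theta>) + b\<bar> \<le> \<bar>a\<bar> * \<bar>x + \<theta>\<bar> + \<bar>b\<bar>"
        by (metis abs_mult abs_triangle_ineq of_int_abs)
      also have "\<dots> \<le> M"
        unfolding M_def using True by (intro add_mono mult_left_mono) auto
      finally have "\<bar>a * x\<^sup>2 + b * x + c\<bar> \<le> \<bar>x - \<theta>\<bar> * M"
        unfolding fac abs_mult by (intro mult_left_mono) auto
      hence "1 \<le> 4 * n\<^sup>2 * (\<bar>x - \<theta>\<bar> * M)"
        by (rule order_trans[OF one mult_left_mono]) auto
      also have "4 * n\<^sup>2 * (\<bar>x - \<theta>\<bar> * M) = (4 * M * \<bar>n\<bar>) * (\<bar>n\<bar> * \<bar>x - \<theta>\<bar>)"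
        using n2 by (simp add: algebra_simps)
      finally show ?thesis using M n1 unfolding nd
        by (simp add: field_simps)
    next
      case False
      have "1 * 1 \<le> 4 * M * \<bar>n\<bar>"
        using M n1 by (intro mult_mono) auto
      hence "1 / (4 * M) / \<bar>n\<bar> \<le> 1 * 1"
        using M n1 by (simp add: field_simps)
      also have "1 * 1 \<le> \<bar>n\<bar> * \<bar>x - \<theta>\<bar>"
        using False n1 by (intro mult_mono) auto
      finally show ?thesis unfolding nd by simp
    qed
  qed
  with M show ?thesis by (intro that[of "1 / (4 * M)"]) auto
qed

lemma abs_sin_pi_ge:
  fixes x :: real
  assumes "\<bar>x\<bar> \<le> 1 / 2"
  shows "\<bar>x\<bar> \<le> \<bar>sin (pi * x)\<bar>"
proof -
  have *: "y \<le> sin (pi * y)" if "0 \<le> y" "y \<le> 1 / 2" for y :: real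
  proof -
    have "convex_on {0..pi} (\<lambda>x. - sin x :: real)"
      by (rule f''_ge0_imp_convex[where f' = "\<lambda>x. - cos x" and f'' = sin])
         (auto intro!: derivative_eq_intros sin_ge_zero)
    \<comment> \<open>Concavity puts the sine above its chord from 0 to \<open>pi / 2\<close>, which
      gives twice the required bound.\<close>
    from convex_onD[OF this, of "2 * y" 0 "pi / 2"] have "2 * y \<le> sin (pi * y)"
      using that by (simp add: mult_ac)
    thus ?thesis using that by simp
  qed
  show ?thesis using *[of "\<bar>x\<bar>"] assms by (cases "x \<ge> 0") auto
qed

text \<open>Majorant for the secant series, indexed by a dyadic block \<open>k\<close> and a cell
  \<open>j\<close> inside the block. The cell \<open>j = 0\<close> contributes 0, since
  \<open>powr\<close> with base 0 is 0.\<close>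

lemma summable_on_geometric_times_powr:
  "(\<lambda>(k::nat, j::int). (1 / sqrt 2) ^ k * \<bar>real_of_int j\<bar> powr (-(3/2))) summable_on UNIV"
proof -
  have 1: "(\<lambda>k. (1 / sqrt 2) ^ k :: real) summable_on UNIV"
    by (subst summable_on_UNIV_nonneg_real_iff) (auto intro!: summable_geometric)
  have nat: "(\<lambda>j::nat. real j powr (-(3/2))) summable_on UNIV"
    by (subst summable_on_UNIV_nonneg_real_iff) (auto simp: summable_real_powr_iff)
  have "(\<lambda>j. \<bar>real_of_int j\<bar> powr (-(3/2))) summable_on (range int)"
    by (subst summable_on_reindex) (auto simp: o_def nat)
  moreover have "(\<lambda>j. \<bar>real_of_int j\<bar> powr (-(3/2))) summable_on (range (\<lambda>n. - int n))"
    by (subst summable_on_reindex) (auto simp: o_def nat inj_on_def)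
  ultimately have "(\<lambda>j. \<bar>real_of_int j\<bar> powr (-(3/2))) summable_on (range int \<union> range (\<lambda>n. - int n))"
    by (rule summable_on_union)
  also have "range int \<union> range (\<lambda>n. - int n) = UNIV"
    by (auto simp: image_iff) (metis int_cases2)
  finally have 2: "(\<lambda>j. \<bar>real_of_int j\<bar> powr (-(3/2))) summable_on UNIV" .
  define s where "s = infsum (\<lambda>j. \<bar>real_of_int j\<bar> powr (-(3/2))) UNIV"
  have "(\<lambda>(k::nat, j::int). (1 / sqrt 2) ^ k * \<bar>real_of_int j\<bar> powr (-(3/2))) summable_on Sigma UNIV (\<lambda>_. UNIV)"
  proof (rule summable_on_SigmaI)
    show "((\<lambda>j. case (k, j) of (k, j) \<Rightarrow> (1 / sqrt 2) ^ k * \<bar>real_of_int j\<bar> powr (-(3/2))) has_sum (1 / sqrt 2) ^ k * s) UNIV" for k :: nat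
      unfolding s_def case_prod_conv by (intro has_sum_cmult_right has_sum_infsum 2)
    show "(\<lambda>k::nat. (1 / sqrt 2) ^ k * s) summable_on UNIV"
      by (intro summable_on_cmult_left 1)
  qed auto
  thus ?thesis by simp
qed

text \<open>A term is large only if \<open>d n\<close>, the signed distance of
  \<open>real (Suc n) * \<theta>\<close> to the nearest half-odd integer, is small. Bad
  approximability keeps these distances apart inside a dyadic block
  \<open>2 ^ k \<le> Suc n < 2 ^ (k + 1)\<close>, so that each cell of width
  \<open>\<delta> / 2 ^ k\<close> holds at most one of them, and the series is dominated by a sum
  over pairs of block and cell.\<close>

lemma summable_sec_over_square:
  fixes \<theta> \<kappa> :: real
  assumes \<kappa>: "\<kappa> > 0"
    and bad: "\<And>n m. n \<noteq> 0 \<Longrightarrow> \<kappa> / real_of_int \<bar>n\<bar> \<le> \<bar>real_of_int n * \<theta> - real_of_int m / 2\<bar>"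
  shows "summable (\<lambda>n. (1 / cos (real (Suc n) * pi * \<theta>)) / (real (Suc n))\<^sup>2)"
proof -
  \<comment> \<open>Half of \<open>\<kappa>\<close> makes \<open>\<bar>t n\<bar> > 1\<close>,
    because \<open>Suc n\<close> is less than twice \<open>2 ^ k n\<close>; hence the cell number
    \<open>j n\<close> is never 0.\<close>
  define \<delta> where "\<delta> = \<kappa> / 2"
  define e where "e n = round (real (Suc n) * \<theta> - 1 / 2)" for n
  define d where "d n = real (Suc n) * \<theta> - 1 / 2 - e n" for n
  have "\<forall>n. \<exists>k. 2 ^ k \<le> Suc n \<and> Suc n < 2 ^ (k + 1)"
    by (intro allI ex_power_ivl1) auto
  then obtain k where k: "\<And>n. 2 ^ k n \<le> Suc n" "\<And>n. Suc n < 2 ^ (k n + 1)" by metis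
  have kr1: "2 ^ k n \<le> real (Suc n)" for n
    using k(1)[of n] by (metis of_nat_le_iff of_nat_numeral of_nat_power)
  have kr2: "real (Suc n) < 2 * 2 ^ k n" for n
    using k(2)[of n] by (metis Suc_eq_plus1 of_nat_less_iff of_nat_numeral of_nat_power power_Suc)
  define t where "t n = d n * 2 ^ k n / \<delta>" for n
  define j where "j n = \<lfloor>t n\<rfloor>" for n
  have \<delta>: "\<delta> > 0" using \<kappa> by (simp add: \<delta>_def)
  have d_le: "\<bar>d n\<bar> \<le> 1 / 2" for n
    using of_int_round_abs_le[of "real (Suc n) * \<theta> - 1 / 2"] by (simp add: d_def e_def abs_minus_commute)
  have d_ge: "\<kappa> / real (Suc n) \<le> \<bar>d n\<bar>" for n
    using bad[of "int (Suc n)" "1 + 2 * e n"] by (simp add: d_def field_simps)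
  have t_abs: "\<bar>t n\<bar> = \<bar>d n\<bar> * 2 ^ k n / \<delta>" for n
    using \<delta> by (simp add: t_def abs_mult)
  have t_gt: "\<bar>t n\<bar> > 1" for n
  proof -
    have "1 < 2 * 2 ^ k n / real (Suc n)"
      using kr2[of n] by (simp add: field_simps)
    also have "\<dots> = \<kappa> / real (Suc n) * 2 ^ k n / \<delta>"
      using \<kappa> by (simp add: \<delta>_def)
    also have "\<dots> \<le> \<bar>t n\<bar>"
      unfolding t_abs using d_ge[of n] \<delta> by (intro divide_right_mono mult_right_mono) auto
    finally show ?thesis .
  qed
  have j_le: "\<bar>real_of_int (j n)\<bar> \<le> 2 * \<bar>t n\<bar>" and j_nz: "j n \<noteq> 0" for n
    using t_gt[of n] unfolding j_def by linarith+
  have t_le: "2 * \<bar>t n\<bar> \<le> 2 ^ k n / \<delta>" for n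
    unfolding t_abs using d_le[of n] \<delta> by (simp add: field_simps)
  \<comment> \<open>Within the dyadic block of \<open>n\<close>, distinct \<open>d n\<close> are more than \<open>\<delta> / 2 ^ k\<close> apart.\<close>
  have inj: "inj (\<lambda>n. (k n, j n))"
  proof (rule injI, rule ccontr)
    fix m n assume eq: "(k m, j m) = (k n, j n)" and "m \<noteq> n"
    define i where "i = int m - int n"
    have i: "i \<noteq> 0" using \<open>m \<noteq> n\<close> by (simp add: i_def)
    have "\<bar>t m - t n\<bar> < 1" using eq unfolding j_def prod.inject by linarith
    hence "\<bar>d m - d n\<bar> * 2 ^ k n / \<delta> < 1"
      using eq \<delta> unfolding t_def prod.inject
      by (simp add: abs_mult flip: diff_divide_distrib left_diff_distrib)
    hence "\<bar>d m - d n\<bar> * 2 ^ k n < \<kappa>" using \<kappa> by (simp add: \<delta>_def field_simps)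
    \<comment> \<open>An even numerator turns the half-integer of the hypothesis into the integer
      \<open>e m - e n\<close>, so the hypothesis also separates two different distances.\<close>
    moreover have "\<kappa> / \<bar>i\<bar> \<le> \<bar>d m - d n\<bar>"
    proof -
      have "of_int i * \<theta> - of_int (2 * (e m - e n)) / 2 = d m - d n"
        by (simp add: d_def i_def algebra_simps diff_divide_distrib)
      thus ?thesis using bad[OF i, of "2 * (e m - e n)"] by simp
    qed
    moreover have "real_of_int \<bar>i\<bar> < 2 ^ k n"
      using kr1[of m] kr1[of n] kr2[of m] kr2[of n] eq unfolding i_def by auto
    ultimately have "\<kappa> / \<bar>i\<bar> * \<bar>i\<bar> < \<kappa>"
      by (smt (verit) \<kappa> divide_nonneg_nonneg mult_mono of_int_0_le_iff)
    thus False using i by simp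
  qed
  define C where "C = 2 / \<delta> * \<delta> powr (-(1/2))"
  have bound: "norm ((1 / cos (real (Suc n) * pi * \<theta>)) / (real (Suc n))\<^sup>2)
      \<le> C * ((1 / sqrt 2) ^ k n * \<bar>real_of_int (j n)\<bar> powr (-(3/2)))" for n
  proof -
    have j1: "\<bar>real_of_int (j n)\<bar> > 0" using j_nz by simp
    have d0: "\<bar>d n\<bar> > 0" using d_ge[of n] \<kappa> by (smt (verit) divide_pos_pos of_nat_0_less_iff zero_less_Suc)
    \<comment> \<open>The half-odd multiple of \<open>pi\<close> turns the cosine into a sine of
      \<open>pi * d n\<close>, up to sign.\<close>
    have "cos (real (Suc n) * pi * \<theta>) = cos (pi * d n + of_int (e n) * pi + pi / 2)"
      by (simp add: d_def algebra_simps)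
    also have "\<bar>\<dots>\<bar> = \<bar>sin (pi * d n)\<bar>"
      by (simp add: cos_add sin_add abs_mult sin_zero_abs_cos_one sin_times_pi_eq_0 mult.commute)
    finally have "\<bar>d n\<bar> \<le> \<bar>cos (real (Suc n) * pi * \<theta>)\<bar>"
      using abs_sin_pi_ge[OF d_le[of n]] by simp
    moreover have "(2 ^ k n)\<^sup>2 \<le> (real (Suc n))\<^sup>2" by (intro power_mono kr1) auto
    ultimately have "norm ((1 / cos (real (Suc n) * pi * \<theta>)) / (real (Suc n))\<^sup>2)
        \<le> (1 / \<bar>d n\<bar>) / (2 ^ k n)\<^sup>2"
      unfolding norm_divide using d0 by (intro frac_le) auto
    also have "\<dots> = 1 / (\<delta> * \<bar>t n\<bar>) * (1 / 2 ^ k n)"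
      using d0 \<delta> by (simp add: t_abs power2_eq_square)
    also have "\<dots> \<le> 2 / (\<delta> * \<bar>j n\<bar>) * (1 / 2 ^ k n)"
      using j_le[of n] j1 \<delta> t_gt[of n] by (intro mult_right_mono) (auto simp: field_simps)
    \<comment> \<open>One half power of \<open>1 / 2 ^ k n\<close> is kept for convergence over the
      blocks. The other is exchanged for a power of \<open>j n\<close> by means of
      \<open>\<delta> * \<bar>j n\<bar> \<le> 2 ^ k n\<close>, which raises the exponent of
      \<open>j n\<close> from 1 to 3/2.\<close>
    also have "1 / 2 ^ k n = (1 / sqrt 2) ^ k n * (2 ^ k n) powr (-(1/2))"
      by (simp add: powr_minus powr_half_sqrt real_sqrt_power field_simps flip: power_mult_distrib)
    also have "2 / (\<delta> * \<bar>j n\<bar>) * ((1 / sqrt 2) ^ k n * (2 ^ k n) powr (-(1/2)))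
        \<le> 2 / (\<delta> * \<bar>j n\<bar>) * ((1 / sqrt 2) ^ k n * (\<delta> * \<bar>j n\<bar>) powr (-(1/2)))"
      using order_trans[OF j_le t_le, of n] j1 \<delta>
      by (intro mult_left_mono powr_mono2') (auto simp: field_simps)
    also have "2 / (\<delta> * \<bar>j n\<bar>) * ((1 / sqrt 2) ^ k n * (\<delta> * \<bar>j n\<bar>) powr (-(1/2)))
        = C * ((1 / sqrt 2) ^ k n * (\<bar>real_of_int (j n)\<bar> powr (-1) * \<bar>real_of_int (j n)\<bar> powr (-(1/2))))"
      using j1 \<delta> by (simp add: C_def powr_mult powr_minus_divide)
    also have "\<bar>real_of_int (j n)\<bar> powr (-1) * \<bar>real_of_int (j n)\<bar> powr (-(1/2))
        = \<bar>real_of_int (j n)\<bar> powr (-(3/2))"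
      by (subst powr_add[symmetric]) simp
    finally show ?thesis .
  qed
  let ?g = "\<lambda>(k::nat, j::int). (1 / sqrt 2) ^ k * \<bar>real_of_int j\<bar> powr (-(3/2))"
  have "?g summable_on range (\<lambda>n. (k n, j n))"
    using summable_on_geometric_times_powr by (rule summable_on_subset) auto
  hence "(?g \<circ> (\<lambda>n. (k n, j n))) summable_on UNIV"
    using inj by (subst (asm) summable_on_reindex) auto
  hence "summable (\<lambda>n. (1 / sqrt 2) ^ k n * \<bar>real_of_int (j n)\<bar> powr (-(3/2)))"
    by (intro summable_on_imp_summable) (simp add: o_def)
  hence "summable (\<lambda>n. C * ((1 / sqrt 2) ^ k n * \<bar>real_of_int (j n)\<bar> powr (-(3/2))))"
    by (rule summable_mult)
  thus ?thesis by (rule summable_comparison_test'[of _ 0]) (rule bound)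
qed

section \<open>Residues of the cotangent-secant kernel\<close>

lemma norm_cos_ge:
  fixes z :: complex
  shows "\<bar>cos (Re z)\<bar> \<le> norm (cos z)" "\<bar>Im z\<bar> \<le> norm (cos z)"
proof -
  \<comment> \<open>The second square is that of the hyperbolic sine of \<open>Im z\<close>, which
    is at least \<open>\<bar>Im z\<bar>\<close> in modulus.\<close>
  have eq: "norm (cos z) ^ 2 = cos (Re z) ^ 2 + ((exp (Im z) - inverse (exp (Im z))) / 2) ^ 2"
    unfolding norm_cos_squared by (simp add: power_divide)
  have "\<bar>Im z\<bar> \<le> \<bar>(exp (Im z) - inverse (exp (Im z))) / 2\<bar>" by (rule real_le_abs_sinh)
  hence "\<bar>Im z\<bar> ^ 2 \<le> norm (cos z) ^ 2"
    unfolding eq by (metis abs_le_square_iff power2_abs le_add_same_cancel2 order_trans zero_le_power2)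
  thus "\<bar>Im z\<bar> \<le> norm (cos z)" by (rule power2_le_imp_le) simp
  have "\<bar>cos (Re z)\<bar> ^ 2 \<le> norm (cos z) ^ 2" unfolding eq by simp
  thus "\<bar>cos (Re z)\<bar> \<le> norm (cos z)" by (rule power2_le_imp_le) simp
qed

lemma norm_sin_ge:
  fixes z :: complex
  shows "\<bar>sin (Re z)\<bar> \<le> norm (sin z)" "\<bar>Im z\<bar> \<le> norm (sin z)"
  using norm_cos_ge[of "of_real pi / 2 - z"] by (simp_all add: sin_cos_eq)

lemma abs_sin_diff_le: "\<bar>sin x - sin y\<bar> \<le> \<bar>x - y\<bar>" for x y :: real
proof -
  have "\<bar>sin x - sin y\<bar> = 2 * \<bar>sin ((x - y) / 2)\<bar> * \<bar>cos ((x + y) / 2)\<bar>"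
    by (simp add: sin_diff_sin abs_mult)
  also have "\<dots> \<le> 2 * \<bar>(x - y) / 2\<bar> * 1"
    by (intro mult_mono abs_sin_x_le_abs_x) auto
  finally show ?thesis by simp
qed

lemma abs_cos_diff_le: "\<bar>cos x - cos y\<bar> \<le> \<bar>x - y\<bar>" for x y :: real
  using abs_sin_diff_le[of "pi / 2 - x" "pi / 2 - y"] by (simp add: cos_sin_eq)

text \<open>A condition at the single real point \<open>norm z\<close> controls the whole circle.
  Passing from \<open>norm z\<close> to \<open>\<bar>Re z\<bar>\<close> costs at most
  \<open>\<bar>a * Im z\<bar>\<close>, and both this and \<open>\<bar>sin (a * Re z)\<bar>\<close>
  are bounded by the complex sine; hence the factor 2.\<close>

lemma norm_sin_ge_on_circle:
  fixes a :: real and z :: complex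
  shows "\<bar>sin (a * norm z)\<bar> \<le> 2 * norm (sin (of_real a * z))"
proof -
  have "\<bar>sin (a * norm z)\<bar> \<le> \<bar>sin (a * \<bar>Re z\<bar>)\<bar> + \<bar>a * norm z - a * \<bar>Re z\<bar>\<bar>"
    using abs_sin_diff_le[of "a * norm z" "a * \<bar>Re z\<bar>"] by linarith
  also have "\<bar>sin (a * \<bar>Re z\<bar>)\<bar> = \<bar>sin (a * Re z)\<bar>" by (cases "Re z \<ge> 0") auto
  also have "\<dots> \<le> norm (sin (of_real a * z))" using norm_sin_ge(1)[of "of_real a * z"] by simp
  also have "\<bar>a * norm z - a * \<bar>Re z\<bar>\<bar> = \<bar>a\<bar> * (norm z - \<bar>Re z\<bar>)"
    using abs_Re_le_cmod[of z] by (simp add: abs_mult flip: right_diff_distrib)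
  also have "\<dots> \<le> \<bar>a\<bar> * \<bar>Im z\<bar>"
    using cmod_le[of z] by (intro mult_left_mono) auto
  also have "\<dots> \<le> norm (sin (of_real a * z))"
    using norm_sin_ge(2)[of "of_real a * z"] by (simp add: abs_mult)
  finally show ?thesis by simp
qed

lemma norm_cos_ge_on_circle:
  fixes a :: real and z :: complex
  shows "\<bar>cos (a * norm z)\<bar> \<le> 2 * norm (cos (of_real a * z))"
proof -
  have "\<bar>cos (a * norm z)\<bar> \<le> \<bar>cos (a * \<bar>Re z\<bar>)\<bar> + \<bar>a * norm z - a * \<bar>Re z\<bar>\<bar>"
    using abs_cos_diff_le[of "a * norm z" "a * \<bar>Re z\<bar>"] by linarith
  also have "\<bar>cos (a * \<bar>Re z\<bar>)\<bar> = \<bar>cos (a * Re z)\<bar>" by (cases "Re z \<ge> 0") auto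
  also have "\<dots> \<le> norm (cos (of_real a * z))" using norm_cos_ge(1)[of "of_real a * z"] by simp
  also have "\<bar>a * norm z - a * \<bar>Re z\<bar>\<bar> = \<bar>a\<bar> * (norm z - \<bar>Re z\<bar>)"
    using abs_Re_le_cmod[of z] by (simp add: abs_mult flip: right_diff_distrib)
  also have "\<dots> \<le> \<bar>a\<bar> * \<bar>Im z\<bar>"
    using cmod_le[of z] by (intro mult_left_mono) auto
  also have "\<dots> \<le> norm (cos (of_real a * z))"
    using norm_cos_ge(2)[of "of_real a * z"] by (simp add: abs_mult)
  finally show ?thesis by simp
qed

section \<open>Residues of the kernel at its poles and its decay on circles\<close>

lemma residue_divide_simple_zero:
  assumes S: "open S" "z \<in> S" and f: "f holomorphic_on S" and g: "g holomorphic_on S"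
    and gz: "g z = 0" and g': "(g has_field_derivative g') (at z)" "g' \<noteq> 0"
  shows "residue (\<lambda>w. f w / g w) z = f z / g'"
proof -
  have lim: "((\<lambda>w. g w / (w - z)) \<longlongrightarrow> g') (at z)"
    using g'(1) gz by (simp add: has_field_derivative_iff)
  have "eventually (\<lambda>w. g w / (w - z) \<noteq> 0) (at z)"
    using tendsto_imp_eventually_ne[OF lim g'(2)] .
  then obtain e where e: "e > 0" "\<And>w. w \<noteq> z \<Longrightarrow> dist w z < e \<Longrightarrow> g w \<noteq> 0"
    by (auto simp: eventually_at)
  show ?thesis
  proof (rule residue_simple'[of "S \<inter> ball z e"])
    show "(\<lambda>w. f w / g w) holomorphic_on S \<inter> ball z e - {z}"
      by (intro holomorphic_on_divide holomorphic_on_subset[OF f] holomorphic_on_subset[OF g])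
         (auto dest: e(2) simp: dist_commute)
    have "isCont f z" using f S holomorphic_on_imp_continuous_on continuous_on_eq_continuous_at by blast
    hence "((\<lambda>w. f w / (g w / (w - z))) \<longlongrightarrow> f z / g') (at z)"
      using g'(2) by (intro tendsto_divide lim) (auto simp: isCont_def)
    thus "((\<lambda>w. f w / g w * (w - z)) \<longlongrightarrow> f z / g') (at z)" by simp
  qed (use S e in auto)
qed

text \<open>The factors \<open>pi\<close> are absorbed into the parameters: the application takes
  \<open>a\<close> to be \<open>pi\<close> times 1, \<open>A\<close> or \<open>B\<close>, and
  \<open>b = pi * r\<close>.\<close>

definition cot_sec_kernel :: "real \<Rightarrow> real \<Rightarrow> complex \<Rightarrow> complex" where
  "cot_sec_kernel a b z = cos (of_real a * z) / (sin (of_real a * z) * z\<^sup>2 * cos (of_real b * z))"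

text \<open>The pole is triple. With \<open>s z\<close> standing for \<open>sin (a * z) / z\<close>,
  the kernel is a regular quotient divided by \<open>z ^ 3\<close>, so the residue is the second
  Taylor coefficient of that quotient.\<close>

lemma residue_cot_sec_kernel_0:
  assumes a: "a \<noteq> 0"
  shows "residue (cot_sec_kernel a b) 0 = of_real (b\<^sup>2 / (2 * a) - a / 3)"
proof -
  define S where "S = fps_shift 1 (fps_sin (of_real a :: complex))"
  define F where "F = fps_cos (of_real a :: complex) / (S * fps_cos (of_real b))"
  define s where "s = (\<lambda>z::complex. if z = 0 then of_real a else sin (of_real a * z) / z ^ 1)"
  have sub: "subdegree (fps_sin (of_real a :: complex)) = 1"
    using a by (intro subdegreeI) (auto simp: fps_sin_def)
  have S: "s has_fps_expansion S"
    unfolding s_def S_def by (intro has_fps_expansion_shift has_fps_expansion_sin) (simp add: sub, simp add: fps_sin_def)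
  have nz: "fps_nth (S * fps_cos (of_real b)) 0 \<noteq> 0"
    using a by (simp add: S_def fps_sin_def fps_cos_def)
  have F: "(\<lambda>z. cos (of_real a * z) / (s z * cos (of_real b * z))) has_fps_expansion F"
    unfolding F_def using nz by (intro has_fps_expansion_divide' has_fps_expansion_cos has_fps_expansion_mult S) 
  have "residue (cot_sec_kernel a b) 0 = residue (\<lambda>z. cos (of_real a * z) / (s z * cos (of_real b * z)) / z ^ Suc 2) 0"
    by (intro residue_cong) (auto simp: cot_sec_kernel_def s_def eventually_at_filter power2_eq_square eval_nat_numeral)
  also have "\<dots> = fps_nth F 2" by (rule residue_fps_expansion_over_power_at_0[OF F])
  also have "\<dots> = of_real (b\<^sup>2 / (2 * a) - a / 3)"
  proof -
    define G where "G = S * fps_cos (of_real b :: complex)"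
    \<comment> \<open>The coefficients of the quotient \<open>F\<close> are found by comparing
      coefficients of order 0, 1 and 2 in this product.\<close>
    have FG: "F * G = fps_cos (of_real a)"
      unfolding F_def G_def[symmetric] using nz
      by (simp add: fps_divide_unit mult.assoc inverse_mult_eq_1 G_def[symmetric])
    have mult2: "fps_nth (A * B) 2 = fps_nth A 0 * fps_nth B 2 + fps_nth A 1 * fps_nth B 1 + fps_nth A 2 * fps_nth B 0"
      for A B :: "complex fps"
      by (simp add: fps_mult_nth numeral_2_eq_2)
    have mult1: "fps_nth (A * B) 1 = fps_nth A 0 * fps_nth B 1 + fps_nth A 1 * fps_nth B 0" for A B :: "complex fps"
      by (simp add: fps_mult_nth)
    have c: "fps_nth (fps_cos (of_real u)) 0 = (1::complex)" "fps_nth (fps_cos (of_real u)) 1 = (0::complex)"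
       "fps_nth (fps_cos (of_real u)) 2 = (of_real (- u\<^sup>2 / 2) :: complex)" for u
      by (simp_all add: fps_cos_def)
    have "fps_nth S 0 = of_real a" "fps_nth S 1 = 0" "fps_nth S 2 = of_real (- (a ^ 3) / 6)"
      by (simp_all add: S_def fps_sin_def fact_numeral)
    hence G: "fps_nth G 0 = of_real a" "fps_nth G 1 = 0" "fps_nth G 2 = of_real (- (a ^ 3) / 6 - a * b\<^sup>2 / 2)"
      using c[of b] by (simp_all add: G_def mult1[unfolded One_nat_def] mult2)
    have "fps_nth F 0 * fps_nth G 0 = 1"
      using arg_cong[OF FG, of "\<lambda>H. fps_nth H 0"] c by simp
    hence F0: "fps_nth F 0 = of_real (1 / a)" using a G by (simp add: field_simps)
    have "fps_nth F 0 * fps_nth G 1 + fps_nth F 1 * fps_nth G 0 = 0"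
      using arg_cong[OF FG, of "\<lambda>H. fps_nth H 1"] c unfolding mult1 by simp
    hence F1: "fps_nth F 1 = 0" using a G by simp
    have "fps_nth F 0 * fps_nth G 2 + fps_nth F 1 * fps_nth G 1 + fps_nth F 2 * fps_nth G 0 = of_real (- a\<^sup>2 / 2)"
      using arg_cong[OF FG, of "\<lambda>H. fps_nth H 2"] c unfolding mult2 by simp
    hence "fps_nth F 2 * of_real a = of_real (- a\<^sup>2 / 2) - of_real (1 / a) * of_real (- (a ^ 3) / 6 - a * b\<^sup>2 / 2)"
      unfolding F0 F1 G mult_zero_left add_0_right eq_diff_eq by (subst add.commute)
    also have "\<dots> = of_real (- a\<^sup>2 / 2 - (1 / a) * (- (a ^ 3) / 6 - a * b\<^sup>2 / 2))"
      by (simp only: of_real_diff of_real_mult)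
    finally have "fps_nth F 2 = of_real ((- a\<^sup>2 / 2 - (1 / a) * (- (a ^ 3) / 6 - a * b\<^sup>2 / 2)) / a)"
      using a unfolding of_real_divide[of _ a] by (simp only: eq_divide_eq of_real_eq_0_iff simp_thms if_True)
    also have "(- a\<^sup>2 / 2 - (1 / a) * (- (a ^ 3) / 6 - a * b\<^sup>2 / 2)) / a = b\<^sup>2 / (2 * a) - a / 3"
      using a by (simp add: field_simps power2_eq_square power3_eq_cube)
    finally show ?thesis .
  qed
  finally show ?thesis .
qed

text \<open>The Pythagorean identity gives \<open>norm (cos u) \<le> 1 + norm (sin u)\<close>, so
  the cotangent is bounded wherever the sine stays away from 0. The remaining decay of order 2 in
  the radius outweighs the length of the circle.\<close>

lemma norm_cot_sec_kernel_le:
  assumes \<delta>: "\<delta> > 0" "\<delta> \<le> \<bar>sin (a * norm z)\<bar>" "\<delta> \<le> \<bar>cos (b * norm z)\<bar>"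
  shows "norm (cot_sec_kernel a b z) \<le> (1 + 2 / \<delta>) * (2 / \<delta>) / (norm z)\<^sup>2"
proof -
  define S where "S = norm (sin (of_real a * z))"
  have S: "\<delta> / 2 \<le> S" using norm_sin_ge_on_circle[of a z] \<delta> by (simp add: S_def)
  have C: "\<delta> / 2 \<le> norm (cos (of_real b * z))" using norm_cos_ge_on_circle[of b z] \<delta> by simp
  have "(cos (of_real a * z))\<^sup>2 = 1 - (sin (of_real a * z))\<^sup>2" by (simp add: cos_squared_eq)
  hence "norm (cos (of_real a * z)) ^ 2 = norm (1 - (sin (of_real a * z))\<^sup>2)"
    by (simp flip: norm_power)
  also have "\<dots> \<le> 1 + S\<^sup>2" unfolding S_def using norm_triangle_ineq4[of 1 "(sin (of_real a * z))\<^sup>2"] by (simp add: norm_power)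
  also have "\<dots> \<le> (1 + S) ^ 2" using S \<delta> by (simp add: power2_sum)
  finally have "norm (cos (of_real a * z)) \<le> 1 + S"
    by (rule power2_le_imp_le) (use S \<delta> in auto)
  hence "norm (cos (of_real a * z)) / S \<le> 1 / S + 1"
    using S \<delta> by (simp add: field_simps)
  also have "1 / S \<le> 2 / \<delta>" using S \<delta> by (simp add: field_simps)
  finally have cot: "norm (cos (of_real a * z)) / S \<le> 1 + 2 / \<delta>" by simp
  have sec: "1 / norm (cos (of_real b * z)) \<le> 1 / (\<delta> / 2)" using C \<delta>(1) by (intro frac_le) auto
  have "norm (cot_sec_kernel a b z) = (norm (cos (of_real a * z)) / S) * (1 / norm (cos (of_real b * z))) / (norm z)\<^sup>2"
    by (simp add: cot_sec_kernel_def S_def norm_divide norm_mult norm_power)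
  also have "\<dots> \<le> (1 + 2 / \<delta>) * (2 / \<delta>) / (norm z)\<^sup>2"
    using cot sec \<delta> by (intro divide_right_mono mult_mono) auto
  finally show ?thesis .
qed

lemma finite_int_affine_bounded:
  fixes u v X :: real
  assumes "u \<noteq> 0"
  shows "finite {n :: int. \<bar>of_int n * u + v\<bar> < X}"
proof (rule finite_subset)
  show "{n :: int. \<bar>of_int n * u + v\<bar> < X} \<subseteq> {- \<lceil>(X + \<bar>v\<bar>) / \<bar>u\<bar>\<rceil>..\<lceil>(X + \<bar>v\<bar>) / \<bar>u\<bar>\<rceil>}"
  proof
    fix n :: int assume "n \<in> {n :: int. \<bar>of_int n * u + v\<bar> < X}"
    hence "\<bar>of_int n * u\<bar> \<le> X + \<bar>v\<bar>" by auto
    hence "\<bar>of_int n\<bar> \<le> (X + \<bar>v\<bar>) / \<bar>u\<bar>" using assms by (simp add: abs_mult field_simps)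
    thus "n \<in> {- \<lceil>(X + \<bar>v\<bar>) / \<bar>u\<bar>\<rceil>..\<lceil>(X + \<bar>v\<bar>) / \<bar>u\<bar>\<rceil>}" by (simp add: abs_le_iff) linarith
  qed
qed auto

text \<open>The derivative of the sine at its zero supplies a factor \<open>cos (a * w)\<close> that
  cancels the numerator of the cotangent; what is left is a term of the secant series at
  \<open>b / a\<close>.\<close>

lemma residue_cot_sec_kernel_sin_zero:
  fixes n :: int
  assumes a: "a \<noteq> 0" and n: "n \<noteq> 0" and nz: "cos (b * (n * pi / a)) \<noteq> 0"
  shows "residue (cot_sec_kernel a b) (of_real (n * pi / a))
    = of_real (a / (pi\<^sup>2 * n\<^sup>2 * cos (n * pi * (b / a))))"
proof -
  define w where "w = n * pi / a"
  define S where "S = {z::complex. z \<noteq> 0 \<and> cos (of_real b * z) \<noteq> 0}"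
  let ?f = "\<lambda>z::complex. cos (of_real a * z) / (z\<^sup>2 * cos (of_real b * z))"
  have "S = {z. z \<noteq> 0} \<inter> {z. cos (of_real b * z) \<noteq> 0}" by (auto simp: S_def)
  hence oS: "open S" by (simp only:) (intro open_Int open_Collect_neq continuous_intros)
  have bw: "cos (of_real b * of_real w :: complex) = of_real (cos (b * w))"
    by (simp flip: cos_of_real of_real_mult)
  have w0: "w \<noteq> 0" using a n by (simp add: w_def)
  have wS: "of_real w \<in> S" using w0 nz bw by (simp add: S_def w_def)
  have aw: "a * w = pi * n" using a by (simp add: w_def)
  have saw: "sin (of_real a * of_real w :: complex) = 0"
    by (simp add: sin_of_real sin_times_pi_eq_0 aw flip: of_real_mult) 
  have caw: "cos (of_real a * of_real w :: complex) \<noteq> 0"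
    using saw sin_cos_squared_add[of "of_real a * of_real w :: complex"] by auto
  have "residue (\<lambda>z. ?f z / sin (of_real a * z)) (of_real w) = ?f (of_real w) / (of_real a * cos (of_real a * of_real w))"
    by (rule residue_divide_simple_zero[OF oS wS])
       (use saw caw a in \<open>auto simp: S_def intro!: holomorphic_intros derivative_eq_intros\<close>)
  also have "(\<lambda>z. ?f z / sin (of_real a * z)) = cot_sec_kernel a b"
    by (simp add: cot_sec_kernel_def fun_eq_iff mult_ac)
  also have "?f (of_real w) / (of_real a * cos (of_real a * of_real w)) = of_real (1 / (a * w\<^sup>2 * cos (b * w)))"
    using caw bw by (simp add: field_simps)
  also have "1 / (a * w\<^sup>2 * cos (b * w)) = a / (pi\<^sup>2 * n\<^sup>2 * cos (n * pi * (b / a)))"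
    using a by (simp add: w_def power2_eq_square field_simps)
  finally show ?thesis by (simp add: w_def)
qed

text \<open>Here \<open>a\<close> enters only through the cotangent of \<open>a * w\<close>, so the
  residue is unchanged when \<open>a * w\<close> moves by a multiple of \<open>pi\<close>.\<close>

lemma residue_cot_sec_kernel_cos_zero:
  assumes b: "b \<noteq> 0" and cw: "cos (b * w) = 0" and sw: "sin (a * w) \<noteq> 0"
  shows "residue (cot_sec_kernel a b) (of_real w) = of_real (- (cos (a * w) / sin (a * w)) / (w\<^sup>2 * b * sin (b * w)))"
proof -
  define S where "S = {z::complex. z \<noteq> 0 \<and> sin (of_real a * z) \<noteq> 0}"
  let ?f = "\<lambda>z::complex. cos (of_real a * z) / (z\<^sup>2 * sin (of_real a * z))"
  have "S = {z. z \<noteq> 0} \<inter> {z. sin (of_real a * z) \<noteq> 0}" by (auto simp: S_def)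
  hence oS: "open S" by (simp only:) (intro open_Int open_Collect_neq continuous_intros)
  have cr: "cos (of_real u * of_real w :: complex) = of_real (cos (u * w))"
    and sr: "sin (of_real u * of_real w :: complex) = of_real (sin (u * w))" for u
    by (simp_all flip: cos_of_real sin_of_real of_real_mult)
  have wS: "of_real w \<in> S" using sw sr[of a] by (auto simp: S_def)
  have sb: "sin (b * w) \<noteq> 0" using cw sin_cos_squared_add[of "b * w"] by auto
  have "residue (\<lambda>z. ?f z / cos (of_real b * z)) (of_real w) = ?f (of_real w) / (- (of_real b * sin (of_real b * of_real w)))"
    by (rule residue_divide_simple_zero[OF oS wS])
       (use cw sb b sr[of b] cr[of b] in \<open>auto simp: S_def intro!: holomorphic_intros derivative_eq_intros\<close>)
  also have "(\<lambda>z. ?f z / cos (of_real b * z)) = cot_sec_kernel a b"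
    by (simp add: cot_sec_kernel_def fun_eq_iff mult_ac)
  finally show ?thesis by (simp add: cr sr mult_ac)
qed

lemma contour_integral_cot_sec_kernel:
  assumes a: "a \<noteq> 0" and b: "b \<noteq> 0" and R: "R > 0"
    and sR: "sin (a * R) \<noteq> 0" and cR: "cos (b * R) \<noteq> 0"
    and nz: "\<And>n::int. n \<noteq> 0 \<Longrightarrow> cos (b * (n * pi / a)) \<noteq> 0"
  shows "contour_integral (circlepath 0 R) (cot_sec_kernel a b) = 2 * pi * \<i> * of_real
     (b\<^sup>2 / (2 * a) - a / 3
      + (\<Sum>n | n \<noteq> 0 \<and> \<bar>of_int n * pi / a\<bar> < R. a / (pi\<^sup>2 * (of_int n)\<^sup>2 * cos (of_int n * pi * (b / a))))
      + (\<Sum>w | \<bar>w\<bar> < R \<and> cos (b * w) = 0. - (cos (a * w) / sin (a * w)) / (w\<^sup>2 * b * sin (b * w))))"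
proof -
  \<comment> \<open>The residue theorem needs an open set containing the closed disc; the poles
    between the radii \<open>R\<close> and \<open>R + 1\<close> drop out later, having winding
    number 0.\<close>
  define S where "S = ball (0::complex) (R + 1)"
  define pts where "pts = {z \<in> S. z = 0 \<or> sin (of_real a * z) = 0 \<or> cos (of_real b * z) = 0}"
  define P where "P = (\<lambda>n::int. of_real (n * pi / a) :: complex)"
  define N where "N X = {n::int. n \<noteq> 0 \<and> \<bar>of_int n * pi / a\<bar> < X}" for X
  define M where "M X = {w::real. \<bar>w\<bar> < X \<and> cos (b * w) = 0}" for X
  have finN: "finite (N X)" for X
    by (rule finite_subset[OF _ finite_int_affine_bounded[of "pi / a" 0 X]]) (use a in \<open>auto simp: N_def\<close>)
  have M_eq: "M X \<subseteq> (\<lambda>n. of_int n * (pi / b) + pi / (2 * b)) ` {n::int. \<bar>of_int n * (pi / b) + pi / (2 * b)\<bar> < X}" for X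
  proof
    fix w assume w: "w \<in> M X"
    then obtain i :: int where "b * w = of_int i * pi + pi / 2"
      by (auto simp: M_def cos_zero_iff_int2)
    hence "w = of_int i * (pi / b) + pi / (2 * b)" using b by (simp add: field_simps)
    thus "w \<in> (\<lambda>n. of_int n * (pi / b) + pi / (2 * b)) ` {n::int. \<bar>of_int n * (pi / b) + pi / (2 * b)\<bar> < X}"
      using w by (auto simp: M_def)
  qed
  have finM: "finite (M X)" for X
    by (rule finite_subset[OF M_eq]) (intro finite_imageI finite_int_affine_bounded, use b in simp)
  \<comment> \<open>All poles are real, so two real index sets describe them.\<close>
  have zeros: "{z. norm z < X \<and> (z = 0 \<or> sin (of_real a * z) = 0 \<or> cos (of_real b * z) = 0)}
      = insert 0 (P ` N X \<union> of_real ` M X)" if "X > 0" for X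
  proof (intro equalityI subsetI)
    fix z :: complex assume z: "z \<in> {z. norm z < X \<and> (z = 0 \<or> sin (of_real a * z) = 0 \<or> cos (of_real b * z) = 0)}"
    then consider "z = 0" | "z \<noteq> 0" "sin (of_real a * z) = 0" | "cos (of_real b * z) = 0" by blast
    thus "z \<in> insert 0 (P ` N X \<union> of_real ` M X)"
    proof cases
      case 2
      then obtain n :: int where "of_real a * z = of_real (n * pi)" by (auto simp: sin_eq_0)
      hence zP: "z = P n" using a by (simp add: P_def field_simps)
      have "norm z = \<bar>of_int n * pi / a\<bar>" unfolding zP P_def by (rule norm_of_real)
      hence "n \<in> N X" using z zP 2 by (auto simp: N_def P_def)
      thus ?thesis using zP by auto
    next
      case 3
      then obtain n :: int where "of_real b * z = of_real (n * pi) + of_real pi / 2" by (auto simp: cos_eq_0)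
      hence zw: "z = of_real ((n * pi + pi / 2) / b)" using b by (simp add: field_simps)
      define w where "w = (n * pi + pi / 2) / b"
      have "of_real (cos (b * w)) = (0 :: complex)" using 3 zw b by (simp add: w_def flip: cos_of_real)
      hence "cos (b * w) = 0" by (simp only: of_real_eq_0_iff)
      moreover have "\<bar>w\<bar> < X" using z unfolding zw w_def[symmetric] by simp
      ultimately have "w \<in> M X" by (simp add: M_def)
      thus ?thesis unfolding zw w_def[symmetric] by blast
    qed auto
  next
    fix z :: complex assume "z \<in> insert 0 (P ` N X \<union> of_real ` M X)"
    then consider "z = 0" | n where "n \<in> N X" "z = P n" | w where "w \<in> M X" "z = of_real w" by auto
    thus "z \<in> {z. norm z < X \<and> (z = 0 \<or> sin (of_real a * z) = 0 \<or> cos (of_real b * z) = 0)}"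
    proof cases
      case (2 n)
      have "norm z = \<bar>of_int n * pi / a\<bar>" unfolding 2 P_def by (rule norm_of_real)
      moreover have "of_real a * z = of_real (of_int n * pi)" using a by (simp add: 2 P_def)
      ultimately show ?thesis using 2(1) by (auto simp: N_def sin_eq_0)
    next
      case (3 w)
      have "cos (of_real b * z) = of_real (cos (b * w))" by (simp add: 3 flip: cos_of_real)
      thus ?thesis using 3 by (auto simp: M_def)
    qed (use that in auto)
  qed
  have "pts = insert 0 (P ` N (R + 1) \<union> of_real ` M (R + 1))"
    using zeros[of "R + 1"] R by (simp add: pts_def S_def dist_norm)
  hence fin: "finite pts" using finN finM by simp
  \<comment> \<open>The lower bounds on the circle carry the conditions at the real point
    \<open>R\<close> over to every point of modulus \<open>R\<close>.\<close>
  have off: "norm z \<noteq> R" if "z \<in> pts" for z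
  proof
    assume zR: "norm z = R"
    have "sin (of_real a * z) \<noteq> 0" using norm_sin_ge_on_circle[of a z] sR zR by auto
    moreover have "cos (of_real b * z) \<noteq> 0" using norm_cos_ge_on_circle[of b z] cR zR by auto
    ultimately show False using that zR R by (auto simp: pts_def)
  qed
  have wn0: "winding_number (circlepath 0 R) z = 0" if "norm z > R" for z
    by (rule winding_number_zero_outside[of _ "cball 0 R"]) (use that R in auto)
  have "contour_integral (circlepath 0 R) (cot_sec_kernel a b)
      = 2 * pi * \<i> * (\<Sum>p\<in>pts. winding_number (circlepath 0 R) p * residue (cot_sec_kernel a b) p)"
  proof (rule Residue_theorem)
    show "open S" "connected S" "finite pts" by (auto simp: S_def fin)
    show "cot_sec_kernel a b holomorphic_on S - pts"
      unfolding cot_sec_kernel_def by (auto intro!: holomorphic_intros simp: pts_def)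
    show "path_image (circlepath 0 R) \<subseteq> S - pts"
      using off R by (auto simp: S_def)
    show "\<forall>z. z \<notin> S \<longrightarrow> winding_number (circlepath 0 R) z = 0"
      using wn0 by (auto simp: S_def)
  qed auto
  also have "(\<Sum>p\<in>pts. winding_number (circlepath 0 R) p * residue (cot_sec_kernel a b) p)
      = (\<Sum>p\<in>{p\<in>pts. norm p < R}. winding_number (circlepath 0 R) p * residue (cot_sec_kernel a b) p)"
    using fin off wn0 by (intro sum.mono_neutral_right) (force simp: not_less)+
  also have "\<dots> = (\<Sum>p\<in>{p\<in>pts. norm p < R}. residue (cot_sec_kernel a b) p)"
    by (intro sum.cong) (auto simp: winding_number_circlepath)
  also have "{p\<in>pts. norm p < R} = insert 0 (P ` N R \<union> of_real ` M R)"
    using R by (subst zeros[symmetric]) (auto simp: pts_def S_def)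
  also have "(\<Sum>p\<in>\<dots>. residue (cot_sec_kernel a b) p) = residue (cot_sec_kernel a b) 0
     + ((\<Sum>p\<in>P ` N R. residue (cot_sec_kernel a b) p) + (\<Sum>p\<in>of_real ` M R. residue (cot_sec_kernel a b) p))"
  proof -
    have "0 \<notin> P ` N R" using a by (auto simp: P_def N_def)
    moreover have "(0::complex) \<notin> of_real ` M R" by (auto simp: M_def)
    moreover have "P n \<noteq> of_real w" if "n \<in> N R" "w \<in> M R" for n w
      using that nz[of n] unfolding P_def N_def M_def of_real_eq_iff by auto
    hence "P ` N R \<inter> of_real ` M R = {}" by auto
    ultimately show ?thesis using finN finM by (simp add: sum.union_disjoint)
  qed
  also have "(\<Sum>p\<in>P ` N R. residue (cot_sec_kernel a b) p) = (\<Sum>n\<in>N R. residue (cot_sec_kernel a b) (P n))"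
    using a by (subst sum.reindex) (auto simp: P_def inj_on_def)
  also have "\<dots> = (\<Sum>n\<in>N R. of_real (a / (pi\<^sup>2 * (of_int n)\<^sup>2 * cos (of_int n * pi * (b / a)))))"
    using residue_cot_sec_kernel_sin_zero[OF a] nz by (intro sum.cong refl) (auto simp: P_def N_def)
  also have "(\<Sum>p\<in>of_real ` M R. residue (cot_sec_kernel a b) p) = (\<Sum>w\<in>M R. residue (cot_sec_kernel a b) (of_real w))"
    by (subst sum.reindex) (auto simp: inj_on_def)
  also have "\<dots> = (\<Sum>w\<in>M R. of_real (- (cos (a * w) / sin (a * w)) / (w\<^sup>2 * b * sin (b * w))))"
  proof (intro sum.cong refl residue_cot_sec_kernel_cos_zero b)
    fix w assume w: "w \<in> M R"
    thus "cos (b * w) = 0" by (simp add: M_def)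
    show "sin (a * w) \<noteq> 0"
    proof
      assume "sin (a * w) = 0"
      then obtain n :: int where n: "a * w = of_int n * pi" by (auto simp: sin_zero_iff_int2)
      hence "w = of_int n * pi / a" using a by (simp add: field_simps)
      \<comment> \<open>For \<open>n = 0\<close> the point \<open>w\<close> would be 0, where the
        cosine equals 1.\<close>
      moreover have "n \<noteq> 0" using w n a by (auto simp: M_def)
      ultimately show False using nz[of n] w by (simp add: M_def)
    qed
  qed
  finally show ?thesis by (simp add: residue_cot_sec_kernel_0[OF a] N_def M_def add.assoc)
qed

section \<open>Limits along circles avoiding the poles\<close>

text \<open>The terms at \<open>n\<close> and \<open>-n\<close> agree. The positive integers
  strictly below \<open>X\<close> are those from 1 to \<open>\<lceil>X\<rceil> - 1\<close>.\<close>

lemma sum_nonzero_int_eq_twice_sum_nat: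
  fixes h :: "nat \<Rightarrow> real"
  shows "(\<Sum>n | n \<noteq> 0 \<and> \<bar>real_of_int n\<bar> < X. h (nat \<bar>n\<bar>)) = 2 * (\<Sum>n<nat (\<lceil>X\<rceil> - 1). h (Suc n))"
proof -
  define L where "L = nat (\<lceil>X\<rceil> - 1)"
  have "{n :: int. n \<noteq> 0 \<and> \<bar>real_of_int n\<bar> < X} = (\<lambda>n. int (Suc n)) ` {..<L} \<union> (\<lambda>n. - int (Suc n)) ` {..<L}" (is "?A = ?B")
  proof (intro equalityI subsetI)
    fix n assume n: "n \<in> ?A"
    hence "\<bar>n\<bar> < \<lceil>X\<rceil>" by (simp add: less_ceiling_iff)
    hence L: "nat \<bar>n\<bar> - 1 < L" using n by (auto simp: L_def)
    show "n \<in> ?B"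
    proof (cases "n > 0")
      case True
      hence "n = int (Suc (nat \<bar>n\<bar> - 1))" by simp
      thus ?thesis using L by blast
    next
      case False
      hence "n = - int (Suc (nat \<bar>n\<bar> - 1))" using n by auto
      thus ?thesis using L by blast
    qed
  next
    fix n assume "n \<in> ?B"
    then obtain m where m: "m < L" "n = int (Suc m) \<or> n = - int (Suc m)" by auto
    hence "int (Suc m) < \<lceil>X\<rceil>" by (auto simp: L_def)
    hence "real (Suc m) < X" by (simp add: less_ceiling_iff)
    thus "n \<in> ?A" using m by auto
  qed
  hence "(\<Sum>n | n \<noteq> 0 \<and> \<bar>real_of_int n\<bar> < X. h (nat \<bar>n\<bar>)) = (\<Sum>n\<in>?B. h (nat \<bar>n\<bar>))" by simp
  also have "\<dots> = (\<Sum>n\<in>(\<lambda>n. int (Suc n)) ` {..<L}. h (nat \<bar>n\<bar>)) + (\<Sum>n\<in>(\<lambda>n. - int (Suc n)) ` {..<L}. h (nat \<bar>n\<bar>))"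
    by (intro sum.union_disjoint) auto
  also have "\<dots> = 2 * (\<Sum>n<L. h (Suc n))"
    by (subst (1 2) sum.reindex) (auto simp: inj_on_def nat_add_distrib)
  finally show ?thesis unfolding L_def .
qed

lemma tendsto_sum_nonzero_int:
  fixes h :: "nat \<Rightarrow> real" and X :: "nat \<Rightarrow> real"
  assumes h: "(\<lambda>n. h (Suc n)) sums s" and X: "filterlim X at_top sequentially"
  shows "(\<lambda>j. \<Sum>n | n \<noteq> 0 \<and> \<bar>real_of_int n\<bar> < X j. h (nat \<bar>n\<bar>)) \<longlonglongrightarrow> 2 * s"
proof -
  define L where "L j = nat (\<lceil>X j\<rceil> - 1)" for j
  have L: "X j - 1 \<le> real (L j)" for j unfolding L_def by linarith
  have "filterlim (\<lambda>j. -1 + X j) at_top sequentially"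
    by (rule filterlim_tendsto_add_at_top[OF tendsto_const X])
  hence "filterlim (\<lambda>j. real (L j)) at_top sequentially"
    by (rule filterlim_at_top_mono) (use L in \<open>auto simp: algebra_simps\<close>)
  hence "filterlim L at_top sequentially" by (simp add: filterlim_sequentially_iff_filterlim_real)
  hence "(\<lambda>j. \<Sum>n<L j. h (Suc n)) \<longlonglongrightarrow> s"
    using h unfolding sums_def by (rule filterlim_compose[rotated])
  thus ?thesis unfolding sum_nonzero_int_eq_twice_sum_nat L_def by (intro tendsto_mult_left)
qed

text \<open>The contour integrals are of order \<open>1 / R j\<close>, so the sum of all enclosed
  residues tends to 0. The residue at the origin is constant and those at the zeros of the sine
  converge to a multiple of the secant series, which determines the limit of the rest.\<close>

lemma residue_sum_cot_sec_kernel_tendsto: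
  fixes R :: "nat \<Rightarrow> real"
  assumes a: "a \<noteq> 0" and b: "b \<noteq> 0" and \<delta>: "\<delta> > 0"
    and R: "\<And>j. R j > 0" "filterlim R at_top sequentially"
    and sR: "\<And>j. \<delta> \<le> \<bar>sin (a * R j)\<bar>" and cR: "\<And>j. \<delta> \<le> \<bar>cos (b * R j)\<bar>"
    and nz: "\<And>n::int. n \<noteq> 0 \<Longrightarrow> cos (of_int n * pi * (b / a)) \<noteq> 0"
    and s: "(\<lambda>n. (1 / cos (real (Suc n) * pi * (b / a))) / (real (Suc n))\<^sup>2) sums s"
  shows "(\<lambda>j. \<Sum>w | \<bar>w\<bar> < R j \<and> cos (b * w) = 0. - (cos (a * w) / sin (a * w)) / (w\<^sup>2 * b * sin (b * w)))
    \<longlonglongrightarrow> - (b\<^sup>2 / (2 * a) - a / 3 + 2 * a / pi\<^sup>2 * s)"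
proof -
  define T where "T j = (\<Sum>w | \<bar>w\<bar> < R j \<and> cos (b * w) = 0. - (cos (a * w) / sin (a * w)) / (w\<^sup>2 * b * sin (b * w)))" for j
  define h where "h n = a / (pi\<^sup>2 * (real n)\<^sup>2 * cos (real n * pi * (b / a)))" for n
  define U where "U j = (\<Sum>n | n \<noteq> 0 \<and> \<bar>real_of_int n\<bar> < \<bar>a\<bar> / pi * R j. h (nat \<bar>n\<bar>))" for j
  define c where "c = b\<^sup>2 / (2 * a) - a / 3"
  define B where "B = (1 + 2 / \<delta>) * (2 / \<delta>)"
  have U_eq: "U j = (\<Sum>n | n \<noteq> 0 \<and> \<bar>of_int n * pi / a\<bar> < R j. a / (pi\<^sup>2 * (of_int n)\<^sup>2 * cos (of_int n * pi * (b / a))))" for j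
    unfolding U_def
  proof (rule sum.cong)
    show "{n :: int. n \<noteq> 0 \<and> \<bar>real_of_int n\<bar> < \<bar>a\<bar> / pi * R j} = {n. n \<noteq> 0 \<and> \<bar>of_int n * pi / a\<bar> < R j}"
      using a by (auto simp: abs_mult field_simps)
    show "h (nat \<bar>n\<bar>) = a / (pi\<^sup>2 * (of_int n)\<^sup>2 * cos (of_int n * pi * (b / a)))" for n
      by (cases "n \<ge> 0") (auto simp: h_def)
  qed
  have main: "norm (c + U j + T j) \<le> B / R j" for j
  proof -
    have "norm (contour_integral (circlepath 0 (R j)) (cot_sec_kernel a b)) \<le> B / (R j)\<^sup>2 * (2 * pi * R j)"
    proof (rule has_contour_integral_bound_circlepath)
      have "cot_sec_kernel a b holomorphic_on {z. norm z = R j}"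
        unfolding cot_sec_kernel_def
      proof (intro holomorphic_intros)
        fix z :: complex assume z: "z \<in> {z. norm z = R j}"
        have "sin (of_real a * z) \<noteq> 0"
          using norm_sin_ge_on_circle[of a z] sR[of j] \<delta> z by auto
        moreover have "cos (of_real b * z) \<noteq> 0"
          using norm_cos_ge_on_circle[of b z] cR[of j] \<delta> z by auto
        ultimately show "sin (of_real a * z) * z\<^sup>2 * cos (of_real b * z) \<noteq> 0"
          using z R(1)[of j] by auto
      qed
      hence "continuous_on (path_image (circlepath 0 (R j))) (cot_sec_kernel a b)"
        using R(1)[of j] by (auto intro!: holomorphic_on_imp_continuous_on simp: sphere_def)
      hence "cot_sec_kernel a b contour_integrable_on circlepath 0 (R j)"
        by (rule contour_integrable_continuous_circlepath)
      thus "(cot_sec_kernel a b has_contour_integral contour_integral (circlepath 0 (R j)) (cot_sec_kernel a b)) (circlepath 0 (R j))"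
        by (rule has_contour_integral_integral)
      show "norm (cot_sec_kernel a b z) \<le> B / (R j)\<^sup>2" if "norm (z - 0) = R j" for z
        using norm_cot_sec_kernel_le[of \<delta> a z b] \<delta> sR[of j] cR[of j] that by (simp add: B_def)
      show "B / (R j)\<^sup>2 \<ge> 0" using \<delta> by (simp add: B_def)
    qed (use R in auto)
    also have "contour_integral (circlepath 0 (R j)) (cot_sec_kernel a b) = 2 * pi * \<i> * of_real (c + U j + T j)"
      unfolding c_def U_eq T_def
    proof (rule contour_integral_cot_sec_kernel[OF a b R(1)])
      show "sin (a * R j) \<noteq> 0" using sR[of j] \<delta> by auto
      show "cos (b * R j) \<noteq> 0" using cR[of j] \<delta> by auto
      show "cos (b * (of_int n * pi / a)) \<noteq> 0" if "n \<noteq> 0" for n using nz[OF that] by (simp add: mult_ac)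
    qed
    also have "norm (2 * pi * \<i> * of_real (c + U j + T j)) = 2 * pi * \<bar>c + U j + T j\<bar>"
      unfolding norm_mult norm_of_real by simp
    finally show ?thesis using R(1)[of j] by (simp add: field_simps power2_eq_square)
  qed
  have "(\<lambda>j. B / R j) \<longlonglongrightarrow> 0"
    by (intro real_tendsto_divide_at_top[OF tendsto_const] R)
  hence lim: "(\<lambda>j. c + U j + T j) \<longlonglongrightarrow> 0"
    by (rule Lim_null_comparison[rotated]) (use main in auto)
  have "(\<lambda>n. h (Suc n)) sums (a / pi\<^sup>2 * s)"
    using sums_mult[OF s, of "a / pi\<^sup>2"] by (simp add: h_def mult_ac)
  hence "U \<longlonglongrightarrow> 2 * (a / pi\<^sup>2 * s)"
    unfolding U_def using a by (intro tendsto_sum_nonzero_int filterlim_tendsto_pos_mult_at_top[OF tendsto_const _ R(2)]) auto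
  from tendsto_diff[OF tendsto_diff[OF lim this] tendsto_const[of c]]
  have "T \<longlonglongrightarrow> 0 - 2 * (a / pi\<^sup>2 * s) - c" by simp
  thus ?thesis by (simp add: T_def[abs_def] c_def algebra_simps)
qed

text \<open>Dirichlet approximation makes \<open>r T\<close> nearly an even integer for large even \<open>T\<close>, so that the
  values of all four trigonometric functions at \<open>T + x\<close> are close to those at a fixed small \<open>x\<close>.\<close>

lemma radii_avoiding_zeros:
  fixes r :: real and K :: nat
  assumes r: "r > 0" and nz: "1 - 2 * K * r \<noteq> 0"
  obtains \<delta> :: real and R :: "nat \<Rightarrow> real" where "\<delta> > 0" "\<And>j. R j > 0" "filterlim R at_top sequentially"
    "\<And>j. \<delta> \<le> \<bar>sin (pi * R j)\<bar>" "\<And>j. \<delta> \<le> \<bar>sin (pi * (1 + 2 * K * r) * R j)\<bar>"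
    "\<And>j. \<delta> \<le> \<bar>sin (pi * (1 - 2 * K * r) * R j)\<bar>" "\<And>j. \<delta> \<le> \<bar>cos (pi * r * R j)\<bar>"
proof -
  \<comment> \<open>For each coefficient \<open>c\<close> in question this gives
    \<open>\<bar>c\<bar> * x \<le> 1 / 4\<close>. All the angles at \<open>x\<close> are then too
    small for a vanishing cosine, and the sines of the nonzero ones do not vanish either.\<close>
  define x where "x = 1 / (4 * (1 + 2 * K * r + r))"
  have pos: "1 + 2 * K * r + r > 0" using r by (simp add: add_pos_nonneg add_nonneg_pos)
  hence x: "x > 0" by (simp add: x_def)
  have small: "\<bar>pi * c * x\<bar> < pi / 2" if "\<bar>c\<bar> \<le> 1 + 2 * K * r + r" for c
  proof -
    have "\<bar>c\<bar> * x \<le> (1 + 2 * K * r + r) * x" using that x by (intro mult_right_mono) auto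
    also have "\<dots> = 1 / 4" using pos by (simp add: x_def)
    finally have "\<bar>c\<bar> * x < 1 / 2" by simp
    hence "pi * (\<bar>c\<bar> * x) < pi * (1 / 2)" by (intro mult_strict_left_mono) auto
    thus ?thesis using x by (simp add: abs_mult mult_ac)
  qed
  have sin_nz: "sin (pi * c * x) \<noteq> 0" if "c \<noteq> 0" "\<bar>c\<bar> \<le> 1 + 2 * K * r + r" for c
  proof -
    have "- pi < pi * c * x" "pi * c * x < pi" using small[OF that(2)] pi_gt_zero by linarith+
    thus ?thesis using sin_eq_0_pi[of "pi * c * x"] that(1) x by auto
  qed
  have cos_nz: "cos (pi * r * x) \<noteq> 0"
  proof -
    have "\<bar>pi * r * x\<bar> < pi / 2" using r by (intro small) simp
    hence "- (pi / 2) < pi * r * x" "pi * r * x < pi / 2" by linarith+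
    thus ?thesis using cos_gt_zero_pi[of "pi * r * x"] by linarith
  qed
  define \<eta> where "\<eta> = Min {\<bar>sin (pi * x)\<bar>, \<bar>sin (pi * (1 + 2 * K * r) * x)\<bar>, \<bar>sin (pi * (1 - 2 * K * r) * x)\<bar>, \<bar>cos (pi * r * x)\<bar>}"
  have Kr: "0 \<le> real K * r" using r by simp
  have \<eta>: "\<eta> > 0"
  proof -
    have "\<bar>1 - 2 * K * r\<bar> \<le> 1 + 2 * K * r + r" using Kr r by linarith
    thus ?thesis
      using sin_nz[of 1] sin_nz[of "1 + 2 * K * r"] sin_nz[of "1 - 2 * K * r"] cos_nz nz r Kr by (auto simp: \<eta>_def)
  qed
  have \<eta>_le: "\<eta> \<le> \<bar>sin (pi * x)\<bar>" "\<eta> \<le> \<bar>sin (pi * (1 + 2 * K * r) * x)\<bar>"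
    "\<eta> \<le> \<bar>sin (pi * (1 - 2 * K * r) * x)\<bar>" "\<eta> \<le> \<bar>cos (pi * r * x)\<bar>" by (auto simp: \<eta>_def)
  \<comment> \<open>This size makes the largest perturbation, at most
    \<open>pi * (1 + 2 * K) * (2 / N)\<close>, no bigger than \<open>\<eta> / 2\<close>; half of the
    minimum \<open>\<eta>\<close> therefore survives.\<close>
  define N where "N = Suc (nat \<lceil>4 * pi * (1 + 2 * K) / \<eta>\<rceil>)"
  have N: "N > 0" "4 * pi * (1 + 2 * K) / \<eta> \<le> N" unfolding N_def by linarith+
  have "\<exists>R. R > real j \<and> \<eta> / 2 \<le> \<bar>sin (pi * R)\<bar> \<and> \<eta> / 2 \<le> \<bar>sin (pi * (1 + 2 * K * r) * R)\<bar> \<and>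
      \<eta> / 2 \<le> \<bar>sin (pi * (1 - 2 * K * r) * R)\<bar> \<and> \<eta> / 2 \<le> \<bar>cos (pi * r * R)\<bar>" for j
  proof -
    \<comment> \<open>Approximating \<open>r * Suc j\<close> in place of \<open>r\<close> makes the
      resulting multiplier \<open>m = k * int (Suc j)\<close> at least \<open>Suc j\<close>, which
      forces the radius beyond \<open>j\<close>.\<close>
    obtain h k where hk: "0 < k" "\<bar>of_int k * (r * Suc j) - of_int h\<bar> < 1 / N"
      using Dirichlet_approx[OF N(1), of "r * Suc j"] by blast
    define m where "m = k * int (Suc j)"
    define \<epsilon> where "\<epsilon> = 2 * (of_int m * r - of_int h)"
    define R where "R = x + 2 * of_int m"
    have "int (Suc j) \<le> m" using hk(1) by (simp add: m_def)
    hence Rj: "R > real j" using x unfolding R_def by linarith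
    have "\<bar>\<epsilon>\<bar> = 2 * \<bar>of_int k * (r * Suc j) - of_int h\<bar>"
      unfolding \<epsilon>_def m_def abs_mult by (simp add: mult_ac)
    hence "\<bar>\<epsilon>\<bar> < 2 / N" using hk(2) by simp
    hence "pi * (1 + 2 * K) * \<bar>\<epsilon>\<bar> \<le> pi * (1 + 2 * K) * (2 / N)" by (intro mult_left_mono) auto
    also have "\<dots> \<le> \<eta> / 2" using N \<eta> by (simp add: field_simps)
    finally have \<epsilon>: "pi * (1 + 2 * K) * \<bar>\<epsilon>\<bar> \<le> \<eta> / 2" .
    have \<epsilon>1: "\<bar>pi * \<epsilon>\<bar> \<le> \<eta> / 2"
      by (rule order_trans[OF _ \<epsilon>]) (simp add: abs_mult algebra_simps)
    have \<epsilon>2: "\<bar>2 * K * pi * \<epsilon>\<bar> \<le> \<eta> / 2"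
      by (rule order_trans[OF _ \<epsilon>]) (simp add: abs_mult algebra_simps)
    have rm: "of_int m * r = \<epsilon> / 2 + of_int h" by (simp add: \<epsilon>_def field_simps)
    have perS: "sin (u + 2 * pi * of_int i) = sin u" and perC: "cos (u + 2 * pi * of_int i) = cos u" for u :: real and i :: int
      by (simp_all add: sin_add cos_add)
    have e1: "pi * R = pi * x + 2 * pi * of_int m" by (simp add: R_def algebra_simps)
    \<comment> \<open>Replacing \<open>of_int m * r\<close> by
      \<open>\<epsilon> / 2 + of_int h\<close> leaves the angle at \<open>x\<close>, a small error
      and a full number of periods.\<close>
    have e2: "pi * (1 + 2 * K * r) * R = pi * (1 + 2 * K * r) * x + 2 * K * pi * \<epsilon> + 2 * pi * of_int (m + 2 * int K * h)"
    proof -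
      have "pi * (1 + 2 * K * r) * R = pi * (1 + 2 * K * r) * x + 2 * pi * of_int m + 4 * pi * K * (of_int m * r)"
        by (simp add: R_def algebra_simps)
      thus ?thesis unfolding rm by (simp add: algebra_simps)
    qed
    have e3: "pi * (1 - 2 * K * r) * R = pi * (1 - 2 * K * r) * x - 2 * K * pi * \<epsilon> + 2 * pi * of_int (m - 2 * int K * h)"
    proof -
      have "pi * (1 - 2 * K * r) * R = pi * (1 - 2 * K * r) * x + 2 * pi * of_int m - 4 * pi * K * (of_int m * r)"
        by (simp add: R_def algebra_simps)
      thus ?thesis unfolding rm by (simp add: algebra_simps)
    qed
    have e4: "pi * r * R = pi * r * x + pi * \<epsilon> + 2 * pi * of_int h"
    proof -
      have "pi * r * R = pi * r * x + 2 * pi * (of_int m * r)" by (simp add: R_def algebra_simps)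
      thus ?thesis unfolding rm by (simp add: algebra_simps)
    qed
    have "\<eta> / 2 \<le> \<bar>sin (pi * R)\<bar>"
      unfolding e1 perS using \<eta>_le(1) \<eta> by linarith
    moreover have "\<eta> / 2 \<le> \<bar>sin (pi * (1 + 2 * K * r) * R)\<bar>"
      unfolding e2 perS
      using abs_sin_diff_le[of "pi * (1 + 2 * K * r) * x + 2 * K * pi * \<epsilon>" "pi * (1 + 2 * K * r) * x"] \<eta>_le(2) \<epsilon>2 by linarith
    moreover have "\<eta> / 2 \<le> \<bar>sin (pi * (1 - 2 * K * r) * R)\<bar>"
      unfolding e3 perS
      using abs_sin_diff_le[of "pi * (1 - 2 * K * r) * x - 2 * K * pi * \<epsilon>" "pi * (1 - 2 * K * r) * x"] \<eta>_le(3) \<epsilon>2 by linarith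
    moreover have "\<eta> / 2 \<le> \<bar>cos (pi * r * R)\<bar>"
      unfolding e4 perC
      using abs_cos_diff_le[of "pi * r * x + pi * \<epsilon>" "pi * r * x"] \<eta>_le(4) \<epsilon>1 by linarith
    ultimately show ?thesis using Rj by blast
  qed
  then obtain R where R: "\<And>j. R j > real j" "\<And>j. \<eta> / 2 \<le> \<bar>sin (pi * R j)\<bar>"
      "\<And>j. \<eta> / 2 \<le> \<bar>sin (pi * (1 + 2 * K * r) * R j)\<bar>"
      "\<And>j. \<eta> / 2 \<le> \<bar>sin (pi * (1 - 2 * K * r) * R j)\<bar>" "\<And>j. \<eta> / 2 \<le> \<bar>cos (pi * r * R j)\<bar>"
    by metis
  have "filterlim R at_top sequentially"
    by (rule filterlim_at_top_mono[OF filterlim_real_sequentially]) (auto intro!: always_eventually less_imp_le R(1))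
  moreover have "R j > 0" for j using R(1)[of j] by linarith
  ultimately show ?thesis using R \<eta> by (intro that[of "\<eta> / 2" R]) auto
qed

section \<open>The secant zeta function at quadratic irrationals\<close>

text \<open>A rational root would make \<open>m * (m + 1)\<close> a perfect square, but this product
  lies strictly between two consecutive squares.\<close>

lemma sqrt_consecutive_product_irrational:
  fixes x :: real and m :: int
  assumes x: "x\<^sup>2 = of_int (m * (m + 1))" and m: "m \<noteq> 0" "m \<noteq> -1"
  shows "x \<notin> \<rat>"
proof
  assume "x \<in> \<rat>"
  then obtain a b :: nat where ab: "b \<noteq> 0" "\<bar>x\<bar> = real a / real b" "coprime a b"
    by (rule Rats_abs_nat_div_natE)
  have "(real a)\<^sup>2 = (\<bar>x\<bar> * real b)\<^sup>2" using ab by simp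
  also have "\<dots> = of_int (m * (m + 1)) * (real b)\<^sup>2" using x by (simp add: power_mult_distrib)
  finally have "real_of_int ((int a)\<^sup>2) = real_of_int (m * (m + 1) * (int b)\<^sup>2)" by simp
  hence eq: "(int a)\<^sup>2 = m * (m + 1) * (int b)\<^sup>2" by (simp only: of_int_eq_iff)
  \<comment> \<open>Divisibility of the squares passes to the bases, and coprimality then leaves
    only the denominator 1.\<close>
  hence "int b dvd int a" by (metis dvd_triv_right pow_divides_pow_iff zero_less_numeral)
  hence "b = 1" using ab(3) by (metis coprime_common_divisor_nat dvd_refl int_dvd_int_iff)
  hence a: "(int a)\<^sup>2 = m * (m + 1)" using eq by simp
  consider "m \<ge> 1" | "m \<le> -2" using m by linarith
  thus False
  proof cases
    case 1
    have "m\<^sup>2 < (int a)\<^sup>2" "(int a)\<^sup>2 < (m + 1)\<^sup>2"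
      unfolding a using 1 by (auto simp: power2_eq_square algebra_simps)
    hence "m < int a" "int a < m + 1" using 1 by (auto dest: power2_less_imp_less)
    thus False by simp
  next
    case 2
    have "(- m - 1)\<^sup>2 < (int a)\<^sup>2" "(int a)\<^sup>2 < (- m)\<^sup>2"
      unfolding a using 2 by (auto simp: power2_eq_square algebra_simps)
    hence "- m - 1 < int a" "int a < - m" using 2 by (auto intro: power2_less_imp_less)
    thus False by simp
  qed
qed

lemma cos_int_pi_irrational_neq_0:
  fixes n :: int
  assumes "\<theta> \<notin> \<rat>" "n \<noteq> 0"
  shows "cos (of_int n * pi * \<theta>) \<noteq> 0"
proof
  assume "cos (of_int n * pi * \<theta>) = 0"
  then obtain i :: int where "of_int n * pi * \<theta> = of_int i * pi + pi / 2" by (auto simp: cos_zero_iff_int2)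
  hence "pi * (of_int n * \<theta>) = pi * (of_int i + 1 / 2)" by (simp add: algebra_simps)
  hence "of_int n * \<theta> = of_int i + 1 / 2" by simp
  hence "\<theta> = (of_int i + 1 / 2) / of_int n" using assms(2) by (simp add: field_simps)
  moreover have "(of_int i + 1 / 2) / of_int n \<in> (\<rat> :: real set)" by simp
  ultimately show False using assms(1) by simp
qed

text \<open>Sine and cosine change by the same sign. At a zero of \<open>sin u\<close> both
  quotients are 0 by the convention for division.\<close>

lemma cot_ratio_add_int_pi:
  fixes u :: real and k :: int
  shows "cos (u + of_int k * pi) / sin (u + of_int k * pi) = cos u / sin u"
proof -
  have s: "sin (of_int k * pi) = 0" by (simp add: sin_zero_iff_int2)
  hence "cos (of_int k * pi) \<noteq> 0" using sin_zero_abs_cos_one by fastforce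
  thus ?thesis by (simp add: sin_add cos_add s)
qed

theorem theorem2p1:
  fixes K :: nat and p :: int and q :: int
  assumes "K > 0" and "p \<noteq> 0" and "q = 2 * int K * (2 * p * int K + 1)"
  shows "summable (\<lambda>n. (1 / cos (real (Suc n) * pi * sqrt (p / q))) / (real (Suc n))^2)
       \<and> secant_zeta (sqrt (p / q)) = 2/3 + p / K - p / q"
proof -
  define r where "r = sqrt (p / q)"
  define A where "A = 1 + 2 * K * r"
  define B where "B = 1 - 2 * K * r"
  define D where "D = 2 * real_of_int p * K + 1"
  have qD: "real_of_int q = 2 * K * D" by (simp add: assms(3) D_def)
  have pD: "real_of_int p / D > 0"
  proof (cases "p > 0")
    case True
    thus ?thesis by (auto simp: D_def intro!: divide_pos_pos add_nonneg_pos)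
  next
    case False
    hence "p * int K \<le> -1 * int K" using assms(2) by (intro mult_right_mono) auto
    hence "2 * p * int K + 1 < 0" using assms(1) by simp
    hence "real_of_int (2 * p * int K + 1) < 0" by (simp only: of_int_less_0_iff)
    hence "D < 0" by (simp add: D_def)
    thus ?thesis using False assms(2) by (intro divide_neg_neg) auto
  qed
  have K: "real K > 0" using assms(1) by simp
  have pq: "real_of_int p / real_of_int q > 0"
  proof -
    have "real_of_int p / real_of_int q = (p / D) / (2 * K)" by (simp add: qD)
    also have "\<dots> > 0" using K by (intro divide_pos_pos[OF pD]) simp
    finally show ?thesis .
  qed
  hence r: "r > 0" and r2: "r\<^sup>2 = p / q" by (simp_all add: r_def)
  have q0: "real_of_int q \<noteq> 0" using pq by auto
  have qr2: "q * r\<^sup>2 = p" using q0 by (simp add: r2)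
  have Dr2: "2 * K * D * r\<^sup>2 = p" using qr2 by (simp add: qD)
  \<comment> \<open>The square of \<open>q * r\<close> is \<open>q * p\<close>, the product of
    \<open>2 * K * p\<close> and its successor. The first factor is even and nonzero, hence neither
    0 nor -1.\<close>
  have irr: "r \<notin> \<rat>"
  proof
    assume "r \<in> \<rat>"
    hence "q * r \<in> \<rat>" by simp
    moreover have "(q * r)\<^sup>2 = of_int ((2 * int K * p) * (2 * int K * p + 1))"
    proof -
      have "(q * r)\<^sup>2 = q * (q * r\<^sup>2)" by (simp add: power2_eq_square)
      also have "\<dots> = of_int ((2 * int K * p) * (2 * int K * p + 1))"
        unfolding qr2 by (simp add: assms(3) algebra_simps)
      finally show ?thesis .
    qed
    moreover have "2 * int K * p \<noteq> 0" using assms by simp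
    moreover have "even (2 * int K * p)" by simp
    hence "2 * int K * p \<noteq> -1" by (metis odd_one even_minus)
    ultimately show False using sqrt_consecutive_product_irrational by blast
  qed
  have A0: "A > 0" using K r by (simp add: A_def add_pos_pos)
  have ABD: "A * B * D = 1"
  proof -
    have "A * B * D = D - 2 * K * (2 * K * D * r\<^sup>2)" by (simp add: A_def B_def algebra_simps power2_eq_square)
    thus ?thesis unfolding Dr2 by (simp add: D_def)
  qed
  hence B0: "B \<noteq> 0" by auto
  \<comment> \<open>Since \<open>A - B = 4 * K * r\<close> and \<open>1 / (A * B) = D\<close>, the
    difference of the two ratios is \<open>4 * K * D * r\<^sup>2\<close>, which is
    \<open>2 * p\<close>.\<close>
  have rB: "r / B = r / A + 2 * p"
  proof -
    have "r * (A - B) = 4 * K * r\<^sup>2 * (A * B * D)"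
      unfolding ABD by (simp add: A_def B_def power2_eq_square)
    hence rAB: "r * (A - B) = 2 * (2 * K * D * r\<^sup>2) * (A * B)" by (simp add: mult_ac)
    have "r / B - r / A = r * (A - B) / (A * B)" using A0 B0 by (simp add: field_simps)
    also have "\<dots> = 2 * (2 * K * D * r\<^sup>2) * (A * B) / (A * B)"
      unfolding rAB ..
    also have "\<dots> = 2 * p" unfolding Dr2 using A0 B0 by simp
    finally show ?thesis by simp
  qed
  have irrA: "r / A \<notin> \<rat>"
  proof
    assume y: "r / A \<in> \<rat>"
    \<comment> \<open>Inverting the fractional linear map that sends \<open>r\<close> to
      \<open>r / A\<close> shows that rationality of \<open>r / A\<close> would pass to
      \<open>r\<close>.\<close>
    have "1 - 2 * K * (r / A) = 1 / A" using A0 by (simp add: A_def field_simps)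
    hence "r = (r / A) / (1 - 2 * K * (r / A))" using A0 by simp
    moreover have "(r / A) / (1 - 2 * K * (r / A)) \<in> \<rat>" by (intro Rats_divide[OF y] Rats_diff Rats_mult[OF _ y]) auto
    ultimately show False using irr by simp
  qed
  have irrB: "r / B \<notin> \<rat>"
  proof
    assume "r / B \<in> \<rat>"
    hence "r / B - 2 * p \<in> \<rat>" by simp
    thus False using irrA rB by simp
  qed
  obtain \<kappa> where \<kappa>: "\<kappa> > 0" "\<And>n m. n \<noteq> 0 \<Longrightarrow> \<kappa> / real_of_int \<bar>n\<bar> \<le> \<bar>real_of_int n * r - real_of_int m / 2\<bar>"
    by (rule quadratic_irrational_badly_approximable[of q r 0 "- p"]) (use qr2 q0 irr in auto)
  note sum1 = summable_sec_over_square[OF \<kappa>]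
  \<comment> \<open>This is the equation \<open>2 * K * D * r\<^sup>2 = p\<close> rewritten for
    \<open>y = r / A\<close> by means of \<open>r = y / (1 - 2 * K * y)\<close>.\<close>
  have quadA: "real_of_int (2 * int K) * (r / A)\<^sup>2 + real_of_int (4 * int K * p) * (r / A) + real_of_int (- p) = 0"
  proof -
    have "2 * K * r\<^sup>2 + 4 * K * p * r * A - p * A\<^sup>2 = 2 * K * D * r\<^sup>2 - p"
      by (simp add: A_def D_def power2_eq_square algebra_simps)
    hence "(2 * K * r\<^sup>2 + 4 * K * p * r * A - p * A\<^sup>2) / A\<^sup>2 = 0" using Dr2 by simp
    thus ?thesis using A0 by (simp add: diff_divide_distrib add_divide_distrib power_divide power2_eq_square)
  qed
  obtain \<kappa>' where \<kappa>': "\<kappa>' > 0" "\<And>n m. n \<noteq> 0 \<Longrightarrow> \<kappa>' / real_of_int \<bar>n\<bar> \<le> \<bar>real_of_int n * (r / A) - real_of_int m / 2\<bar>"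
    by (rule quadratic_irrational_badly_approximable[OF quadA]) (use assms(1) irrA in auto)
  note sumA = summable_sec_over_square[OF \<kappa>']
  define s where "s = (\<Sum>n. (1 / cos (real (Suc n) * pi * r)) / (real (Suc n))\<^sup>2)"
  define t where "t = (\<Sum>n. (1 / cos (real (Suc n) * pi * (r / A))) / (real (Suc n))\<^sup>2)"
  \<comment> \<open>The arguments differ by a multiple of \<open>2 * pi\<close>, so one sum
    \<open>t\<close> serves for both \<open>A\<close> and \<open>B\<close>.\<close>
  have cosAB: "cos (real (Suc n) * pi * (r / B)) = cos (real (Suc n) * pi * (r / A))" for n
  proof -
    have "real (Suc n) * pi * (r / B) = real (Suc n) * pi * (r / A) + 2 * pi * of_int (int (Suc n) * p)"
      unfolding rB by (simp add: algebra_simps)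
    thus ?thesis by (simp only: cos_add sin_int_2pin cos_int_2pin mult_1_right mult_zero_right diff_zero)
  qed
  \<comment> \<open>The redundant factors \<open>pi\<close> put the series into the shape
    \<open>b / a\<close> with \<open>b = pi * r\<close> that the limit lemma expects.\<close>
  have s1: "(\<lambda>n. (1 / cos (real (Suc n) * pi * (pi * r / pi))) / (real (Suc n))\<^sup>2) sums s"
    using summable_sums[OF sum1] by (simp add: s_def)
  have tA: "(\<lambda>n. (1 / cos (real (Suc n) * pi * (pi * r / (pi * A)))) / (real (Suc n))\<^sup>2) sums t"
    using summable_sums[OF sumA] by (simp add: t_def)
  have tB: "(\<lambda>n. (1 / cos (real (Suc n) * pi * (pi * r / (pi * B)))) / (real (Suc n))\<^sup>2) sums t"
    using summable_sums[OF sumA] cosAB by (simp add: t_def)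
  obtain \<delta> R where \<delta>: "\<delta> > 0" and R: "\<And>j. R j > 0" "filterlim R at_top sequentially"
    and sR: "\<And>j. \<delta> \<le> \<bar>sin (pi * R j)\<bar>" "\<And>j. \<delta> \<le> \<bar>sin (pi * A * R j)\<bar>" "\<And>j. \<delta> \<le> \<bar>sin (pi * B * R j)\<bar>"
    and cR: "\<And>j. \<delta> \<le> \<bar>cos (pi * r * R j)\<bar>"
    using radii_avoiding_zeros[OF r, of K] B0 unfolding A_def B_def by metis
  define T where "T a j = (\<Sum>w | \<bar>w\<bar> < R j \<and> cos (pi * r * w) = 0.
      - (cos (a * w) / sin (a * w)) / (w\<^sup>2 * (pi * r) * sin (pi * r * w)))" for a j
  have lim: "T a \<longlonglongrightarrow> - ((pi * r)\<^sup>2 / (2 * a) - a / 3 + 2 * a / pi\<^sup>2 * u)"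
    if "a \<noteq> 0" "\<And>j. \<delta> \<le> \<bar>sin (a * R j)\<bar>" "pi * r / a \<notin> \<rat>"
       "(\<lambda>n. (1 / cos (real (Suc n) * pi * (pi * r / a))) / (real (Suc n))\<^sup>2) sums u" for a u
    unfolding T_def[abs_def] using r that cos_int_pi_irrational_neq_0[OF that(3)]
    by (intro residue_sum_cot_sec_kernel_tendsto[OF _ _ \<delta> R _ cR]) auto
  \<comment> \<open>At a zero of \<open>cos (pi * r * w)\<close> the product
    \<open>pi * r * w\<close> is an odd multiple of \<open>pi / 2\<close>, so adding
    \<open>2 * k\<close> copies of it shifts the argument of the cotangent by a multiple of
    \<open>pi\<close>.\<close>
  have shift: "T (pi * (1 + 2 * of_int k * r)) j = T pi j" for k :: int and j
    unfolding T_def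
  proof (intro sum.cong refl)
    fix w assume "w \<in> {w. \<bar>w\<bar> < R j \<and> cos (pi * r * w) = 0}"
    then obtain i :: int where i: "pi * r * w = of_int i * pi + pi / 2" by (auto simp: cos_zero_iff_int2)
    have "pi * (1 + 2 * of_int k * r) * w = pi * w + 2 * of_int k * (pi * r * w)" by (simp add: algebra_simps)
    also have "\<dots> = pi * w + of_int (k * (2 * i + 1)) * pi" unfolding i by (simp add: algebra_simps)
    finally show "- (cos (pi * (1 + 2 * of_int k * r) * w) / sin (pi * (1 + 2 * of_int k * r) * w)) / (w\<^sup>2 * (pi * r) * sin (pi * r * w))
       = - (cos (pi * w) / sin (pi * w)) / (w\<^sup>2 * (pi * r) * sin (pi * r * w))"
      by (simp only: cot_ratio_add_int_pi)
  qed
  have TA: "T (pi * A) = T pi" using shift[of "int K"] by (simp add: A_def fun_eq_iff)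
  have TB: "T (pi * B) = T pi" using shift[of "- int K"] by (simp add: B_def fun_eq_iff)
  define e where "e = (pi * r)\<^sup>2 / (2 * pi) - pi / 3 + 2 * pi / pi\<^sup>2 * s"
  have l1: "T pi \<longlonglongrightarrow> - e"
    unfolding e_def by (rule lim) (use s1 sR irr in auto)
  have lA: "T pi \<longlonglongrightarrow> - ((pi * r)\<^sup>2 / (2 * (pi * A)) - pi * A / 3 + 2 * (pi * A) / pi\<^sup>2 * t)"
    unfolding TA[symmetric] by (rule lim) (use tA sR irrA A0 in auto)
  have lB: "T pi \<longlonglongrightarrow> - ((pi * r)\<^sup>2 / (2 * (pi * B)) - pi * B / 3 + 2 * (pi * B) / pi\<^sup>2 * t)"
    unfolding TB[symmetric] by (rule lim) (use tB sR irrB B0 in auto)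
  have eA: "e = (pi * r)\<^sup>2 / (2 * (pi * A)) - pi * A / 3 + 2 * (pi * A) / pi\<^sup>2 * t"
    using LIMSEQ_unique[OF l1 lA] by simp
  have eB: "e = (pi * r)\<^sup>2 / (2 * (pi * B)) - pi * B / 3 + 2 * (pi * B) / pi\<^sup>2 * t"
    using LIMSEQ_unique[OF l1 lB] by simp
  \<comment> \<open>Weighting the equation for \<open>B\<close> by \<open>A\<close> and the one for
    \<open>A\<close> by \<open>B\<close> gives \<open>t\<close> and the linear term the same
    coefficient \<open>A * B\<close> up to constants, so both cancel and \<open>e\<close> is
    determined without knowing \<open>t\<close>.\<close>
  have "(A - B) * e = A * e - B * e" by (simp add: algebra_simps)
  also have "\<dots> = A * ((pi * r)\<^sup>2 / (2 * (pi * B)) - pi * B / 3 + 2 * (pi * B) / pi\<^sup>2 * t)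
      - B * ((pi * r)\<^sup>2 / (2 * (pi * A)) - pi * A / 3 + 2 * (pi * A) / pi\<^sup>2 * t)"
    using eA eB by simp
  also have "\<dots> = pi * r\<^sup>2 / 2 * (A / B - B / A)"
    by (simp add: power_mult_distrib power2_eq_square algebra_simps)
  also have "A / B - B / A = (A - B) * (A + B) / (A * B)" using A0 B0 by (simp add: field_simps)
  also have "\<dots> = (A - B) * (2 * D)"
  proof -
    have "A + B = 2" by (simp add: A_def B_def)
    moreover have "1 / (A * B) = D" using ABD A0 B0 by (simp add: field_simps)
    ultimately show ?thesis by (metis (no_types) divide_inverse inverse_eq_divide mult.assoc)
  qed
  finally have "(A - B) * e = (A - B) * (pi * r\<^sup>2 * D)" by (simp add: mult_ac)
  moreover have "A - B \<noteq> 0" using K r by (simp add: A_def B_def)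
  ultimately have e: "e = pi * r\<^sup>2 * D" by simp
  \<comment> \<open>With \<open>e\<close> known, its definition is an equation for \<open>s\<close>
    alone.\<close>
  have "2 / pi * s = pi * (r\<^sup>2 * D - r\<^sup>2 / 2 + 1 / 3)"
    using e unfolding e_def by (simp add: power_mult_distrib power2_eq_square algebra_simps)
  hence "4 / pi\<^sup>2 * s = 2 / 3 + r\<^sup>2 * (2 * D) - r\<^sup>2"
    by (simp add: field_simps power2_eq_square)
  also have "r\<^sup>2 * (2 * D) = p / K" using Dr2 K by (simp add: field_simps)
  finally have "secant_zeta r = 2 / 3 + p / K - p / q"
    unfolding secant_zeta_def s_def[symmetric] r2 .
  with sum1 show ?thesis by (simp add: r_def)
qed

end
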